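(* Let $\Bbbk$ be a field and let $(A,\mathcal F^\bullet)$ be a $C$-linearly simple filtered $\Bbbk$-algebra (for some positive integer $C$) with finite dimension and positive finite multiplicity. If $M$ is a holonomic $A$-module, then $M$ has finite length as an $A$-module. Furthermore, $$\operatorname{length}_A M\le \frac{\operatorname{e}(\mathcal G^\bullet)^2\,(C+1)^\theta (C+2)^\theta}{\operatorname{e}(\mathcal F^\bullet)}$$ for any filtration $\mathcal G^\bullet$ on $M$ (compatible with $\mathcal F^\bullet$) of dimension $\theta:=\frac12\operatorname{Dim}(\mathcal F^\bullet)$ and finite multiplicity.
   Context: $A$ is an associative, not necessarily commutative, $\Bbbk$-algebra. A filtration $\mathcal F^\bullet$ on $A$ is an ascending exhaustive sequence $(\mathcal F^i)_{i\in\mathbb N}$ of finite-dimensional $\Bbbk$-subspaces with $\mathcal F^0=\Bbbk$ and $\mathcal F^i\mathcal F^j\subseteq\mathcal F^{i+j}$; $(A,\mathcal F^\bullet)$ is then a filtered $\Bbbk$-algebra. A filtration on a left (resp. right) $A$-module $M$ compatible with $\mathcal F^\bullet$ is an ascending exhaustive sequence $(\mathcal G^i)_{i\in\mathbb N}$ of finite-dimensional $\Bbbk$-subspaces with $\mathcal F^i\mathcal G^j\subseteq\mathcal G^{i+j}$ (resp. $\mathcal G^j\mathcal F^i\subseteq\mathcal G^{i+j}$) for all $i,j$. For an ascending sequence $\mathcal G^\bullet$ of finite-dimensional $\Bbbk$-spaces, $\operatorname{Dim}(\mathcal G^\bullet)=\inf\{t\in\mathbb R_{\ge0} : \exists\,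 C',\ \dim_\Bbbk\mathcal G^i\le C'i^t\ \forall i\gg0\}$; if $d=\operatorname{Dim}(\mathcal G^\bullet)$ is finite, $\operatorname e(\mathcal G^\bullet)=\limsup_{i\to\infty}\dim_\Bbbk\mathcal G^i/i^d\in\mathbb R_{\ge0}\cup\{\infty\}$; otherwise $\operatorname e(\mathcal G^\bullet)=\infty$. The dimension and multiplicity of $(A,\mathcal F^\bullet)$ are those of $\mathcal F^\bullet$. $(A,\mathcal F^\bullet)$ is $C$-linearly simple if for each $i\in\mathbb N$ and each nonzero $\delta\in\mathcal F^i$, $1\in\mathcal F^{Ci}\,\delta\,\mathcal F^{Ci}$ (the $\Bbbk$-span of products). For a linearly simple $(A,\mathcal F^\bullet)$ with $\operatorname{Dim}(\mathcal F^\bullet)<\infty$ and $0<\operatorname e(\mathcal F^\bullet)<\infty$, a nonzero $A$-module is holonomic if it admits a compatible filtration of dimension $\frac12\operatorname{Dim}(\mathcal F^\bullet)$ and finite multiplicity; the zero module is holonomic by convention. *)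

theory Defs
  imports Complex_Main "HOL-Library.Extended_Real"
begin

locale assoc_algebra = vector_space scale
  for scale :: "'k::field \<Rightarrow> 'a::ring_1 \<Rightarrow> 'a" +
  assumes scale_mult_left: "scale c x * y = scale c (x * y)"
    and scale_mult_right: "x * scale c y = scale c (x * y)"

definition fin_dim_subspace :: "('k::field \<Rightarrow> 'v::ab_group_add \<Rightarrow> 'v) \<Rightarrow> 'v set \<Rightarrow> bool" where
  "fin_dim_subspace scale V \<longleftrightarrow>
     module.subspace scale V \<and> (\<exists>B. finite B \<and> V \<subseteq> module.span scale B)"

definition exhaustive_fin_dim_seq ::
    "('k::field \<Rightarrow> 'v::ab_group_add \<Rightarrow> 'v) \<Rightarrow> (nat \<Rightarrow> 'v set) \<Rightarrow> bool" where
  "exhaustive_fin_dim_seq scale G \<longleftrightarrow>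
     (\<forall>i. fin_dim_subspace scale (G i)) \<and> mono G \<and> (\<Union>i. G i) = UNIV"

locale filtered_algebra = assoc_algebra scale
  for scale :: "'k::field \<Rightarrow> 'a::ring_1 \<Rightarrow> 'a" +
  fixes F :: "nat \<Rightarrow> 'a set"
  assumes seq: "exhaustive_fin_dim_seq scale F"
    and F_0: "F 0 = range (\<lambda>c. scale c 1)"
    and F_mult: "a \<in> F i \<Longrightarrow> b \<in> F j \<Longrightarrow> a * b \<in> F (i + j)"

text \<open>
  An action is always written \<open>act a m\<close>, also for a right module, where it stands for
  \<open>m \<cdot> a\<close>. The two kinds of modules then differ only in the associativity law, and
  submodules, length and compatible filtrations are defined uniformly for both.
\<close>

locale module_action =
  fixes act :: "'a::ring_1 \<Rightarrow> 'm::ab_group_add \<Rightarrow> 'm"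
  assumes act_add_right: "act a (m + n) = act a m + act a n"
    and act_add_left: "act (a + b) m = act a m + act b m"
    and act_one: "act 1 m = m"

locale left_module = module_action act
  for act :: "'a::ring_1 \<Rightarrow> 'm::ab_group_add \<Rightarrow> 'm" +
  assumes act_mult: "act (a * b) m = act a (act b m)"

locale right_module = module_action act
  for act :: "'a::ring_1 \<Rightarrow> 'm::ab_group_add \<Rightarrow> 'm" +
  assumes act_mult: "act (a * b) m = act b (act a m)"

text \<open>The vector space structure of a module is the one induced by the scalars in the algebra.\<close>

definition module_scale ::
    "('k::field \<Rightarrow> 'a::ring_1 \<Rightarrow> 'a) \<Rightarrow> ('a \<Rightarrow> 'm::ab_group_add \<Rightarrow> 'm) \<Rightarrow> 'k \<Rightarrow> 'm \<Rightarrow> 'm" where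
  "module_scale scale act c m = act (scale c 1) m"

definition compatible_filtration ::
    "('k::field \<Rightarrow> 'a::ring_1 \<Rightarrow> 'a) \<Rightarrow> (nat \<Rightarrow> 'a set) \<Rightarrow> ('a \<Rightarrow> 'm::ab_group_add \<Rightarrow> 'm) \<Rightarrow>
      (nat \<Rightarrow> 'm set) \<Rightarrow> bool" where
  "compatible_filtration scale F act G \<longleftrightarrow>
     exhaustive_fin_dim_seq (module_scale scale act) G \<and>
     (\<forall>i j. \<forall>a\<in>F i. \<forall>m\<in>G j. act a m \<in> G (i + j))"

text \<open>The value is \<open>\<infinity>\<close> (infimum of the empty set) if there is no polynomial bound.\<close>

definition filt_dim ::
    "('k::field \<Rightarrow> 'v::ab_group_add \<Rightarrow> 'v) \<Rightarrow> (nat \<Rightarrow> 'v set) \<Rightarrow> ereal" where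
  "filt_dim scale G =
     Inf (ereal ` {t. 0 \<le> t \<and>
       (\<exists>C'::real. \<forall>\<^sub>F i in sequentially.
          real (vector_space.dim scale (G i)) \<le> C' * real i powr t)})"

definition filt_mult ::
    "('k::field \<Rightarrow> 'v::ab_group_add \<Rightarrow> 'v) \<Rightarrow> (nat \<Rightarrow> 'v set) \<Rightarrow> ereal" where
  "filt_mult scale G =
     (if filt_dim scale G = \<infinity> then \<infinity>
      else limsup (\<lambda>i. ereal (real (vector_space.dim scale (G i)) /
                              real i powr real_of_ereal (filt_dim scale G))))"

definition linearly_simple ::
    "('k::field \<Rightarrow> 'a::ring_1 \<Rightarrow> 'a) \<Rightarrow> (nat \<Rightarrow> 'a set) \<Rightarrow> nat \<Rightarrow> bool" where
  "linearly_simple scale F C \<longleftrightarrow>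
     (\<forall>i. \<forall>\<delta>\<in>F i. \<delta> \<noteq> 0 \<longrightarrow>
        1 \<in> module.span scale {a * \<delta> * b | a b. a \<in> F (C * i) \<and> b \<in> F (C * i)})"

text \<open>
  Meaningful over a linearly simple filtered algebra of finite dimension and positive finite
  multiplicity.
\<close>

definition holonomic ::
    "('k::field \<Rightarrow> 'a::ring_1 \<Rightarrow> 'a) \<Rightarrow> (nat \<Rightarrow> 'a set) \<Rightarrow> ('a \<Rightarrow> 'm::ab_group_add \<Rightarrow> 'm) \<Rightarrow> bool" where
  "holonomic scale F act \<longleftrightarrow>
     (UNIV :: 'm set) = {0} \<or>
     (\<exists>G. compatible_filtration scale F act G \<and>
          filt_dim (module_scale scale act) G = filt_dim scale F / 2 \<and>
          filt_mult (module_scale scale act) G < \<infinity>)"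

definition submodule :: "('a::ring_1 \<Rightarrow> 'm::ab_group_add \<Rightarrow> 'm) \<Rightarrow> 'm set \<Rightarrow> bool" where
  "submodule act N \<longleftrightarrow>
     0 \<in> N \<and> (\<forall>m\<in>N. \<forall>n\<in>N. m + n \<in> N) \<and> (\<forall>a. \<forall>m\<in>N. act a m \<in> N)"

text \<open>The supremum of all \<open>n\<close> with a chain \<open>0 = N\<^sub>0 \<subset> N\<^sub>1 \<subset> \<dots> \<subset> N\<^sub>n = M\<close> of submodules.\<close>

definition module_length :: "('a::ring_1 \<Rightarrow> 'm::ab_group_add \<Rightarrow> 'm) \<Rightarrow> enat" where
  "module_length act =
     Sup {enat n | n. \<exists>N. N 0 = {0} \<and> N n = UNIV \<and>
            (\<forall>i\<le>n. submodule act (N i)) \<and> (\<forall>i<n. N i \<subset> N (Suc i))}"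

end

theory Submission
  imports Defs
begin

text \<open>
  The theorem is a Bernstein inequality applied to all factors of a chain of submodules at once.

  Let \<open>N' \<subset> N\<close> be submodules of \<open>M\<close>, and write \<open>U i\<close> for the \<open>i\<close>-th step of the filtration that
  \<open>\<G>\<close> induces on \<open>N/N'\<close>. Linear simplicity keeps small elements from
  acting as zero on the subquotient: if \<open>0 \<noteq> \<delta> \<in> \<F>\<^sup>i\<close>, then \<open>1\<close> lies in the span of
  \<open>\<F>\<^bsup>Ci\<^esup> \<delta> \<F>\<^bsup>Ci\<^esup>\<close>, so \<open>\<delta>\<close> cannot annihilate \<open>U ((C + 1) i)\<close>, provided that
  \<open>U i \<noteq> 0\<close> (lemma \<open>nonzero_acts_nontrivially\<close>). Hence \<open>\<F>\<^sup>i\<close> embeds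
  into \<open>Hom (U ((C + 1) i), U ((C + 2) i))\<close>, which gives
  \<open>dim \<F>\<^sup>i \<le> dim U ((C + 1) i) \<cdot> dim U ((C + 2) i)\<close> for all large \<open>i\<close>
  (lemma \<open>bernstein_subquotient\<close>).

  For a chain of \<open>n\<close> proper inclusions from \<open>0\<close> to \<open>M\<close>, sum this over the \<open>n\<close> factors. The dimensions of the
  induced filtrations add up to that of \<open>\<G>\<close>, and a sum of products of
  nonnegative numbers is at most the product of the sums, so
  \<open>n \<cdot> dim \<F>\<^sup>i \<le> dim \<G>\<^bsup>(C + 1) i\<^esup> \<cdot> dim \<G>\<^bsup>(C + 2) i\<^esup>\<close>
  (lemma \<open>chain_dim_bound\<close>). Dividing by \<open>i\<^bsup>2\<theta>\<^esup>\<close> and taking the limes superior bounds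
  \<open>n\<close> as claimed, and a nonzero holonomic module has at least one \<open>\<G>\<close> for which this bound
  is finite. Summing before passing to the limit is what avoids comparing multiplicities of the
  single factors, for which the limes superior is not additive. Left and right modules need no
  separate treatment, because the condition on \<open>\<F>\<^bsup>Ci\<^esup> \<delta> \<F>\<^bsup>Ci\<^esup>\<close> is symmetric in the two
  outer factors.
\<close>

section \<open>Separating linear functionals\<close>

context vector_space
begin

text \<open>
  Each functional cuts the dimension by at most one: the induction replaces \<open>W\<close> by the
  kernel of one functional in \<open>W\<close>, which spans \<open>W\<close> together with any vector of \<open>W\<close> outside of it.
\<close>

lemma span_of_joint_kernel_trivial:
  assumes "finite I" "subspace W"
    and "\<And>i. i \<in> I \<Longrightarrow> Vector_Spaces.linear scale (*) (f i)"
    and "\<And>x. x \<in> W \<Longrightarrow> (\<forall>i\<in>I. f i x = 0) \<Longrightarrow> x = 0"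
  shows "\<exists>B. finite B \<and> card B \<le> card I \<and> W \<subseteq> span B"
  using assms
proof (induction I arbitrary: W rule: finite_induct)
  case empty
  then have "W \<subseteq> span {}" by auto
  then show ?case by (metis card.empty finite.emptyI order_refl)
next
  case (insert j I)
  interpret fj: Vector_Spaces.linear scale "(*)" "f j" using insert.prems(2) by blast
  define K where "K = {x \<in> W. f j x = 0}"
  have "subspace K"
    unfolding K_def using insert.prems(1)
    by (intro subspaceI) (auto simp: subspace_0 subspace_add subspace_scale fj.add fj.scale fj.zero)
  moreover have "\<And>x. x \<in> K \<Longrightarrow> (\<forall>i\<in>I. f i x = 0) \<Longrightarrow> x = 0"
    unfolding K_def using insert.prems(3) by auto
  ultimately obtain B where B: "finite B" "card B \<le> card I" "K \<subseteq> span B"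
    using insert.IH insert.prems(2) by (metis insertCI)
  show ?case
  proof (cases "W \<subseteq> K")
    case True
    then show ?thesis using B insert.hyps by (intro exI[of _ B]) auto
  next
    case False
    then obtain w where w: "w \<in> W" "f j w \<noteq> 0" unfolding K_def by auto
    have "x \<in> span (insert w B)" if x: "x \<in> W" for x
    proof -
      let ?c = "f j x / f j w"
      have "x - scale ?c w \<in> K"
        unfolding K_def using insert.prems(1) x w
        by (auto simp: subspace_diff subspace_scale fj.diff fj.scale)
      then show ?thesis using B(3) by (auto simp: span_insert)
    qed
    moreover have "card (insert w B) \<le> card (insert j I)"
      using B insert.hyps by (simp add: card_insert_if)
    ultimately show ?thesis using B(1) by (intro exI[of _ "insert w B"]) auto
  qed
qed

lemma dim_le_card_if_joint_kernel_trivial: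
  assumes "finite I" "subspace W"
    and "\<And>i. i \<in> I \<Longrightarrow> Vector_Spaces.linear scale (*) (f i)"
    and "\<And>x. x \<in> W \<Longrightarrow> (\<forall>i\<in>I. f i x = 0) \<Longrightarrow> x = 0"
  shows "dim W \<le> card I"
proof -
  obtain B where "finite B" "card B \<le> card I" "W \<subseteq> span B"
    using span_of_joint_kernel_trivial[of I W f, OF assms] by blast
  then show ?thesis using dim_le_card[of W B] by linarith
qed

text \<open>
  A basis \<open>D\<close> of \<open>V\<close> modulo \<open>V'\<close> with coordinate functions \<open>\<phi>\<close> that are linear on the whole
  space. This encodes \<open>V/V'\<close> without a quotient type.
\<close>

lemma relative_basis:
  assumes V: "subspace V" "finite S" "V \<subseteq> span S" and V': "subspace V'" "V' \<subseteq> V"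
  obtains D \<phi> where "D \<subseteq> V" "finite D" "card D + dim V' = dim V" "V \<subseteq> span (V' \<union> D)"
    "\<forall>b. Vector_Spaces.linear scale (*) (\<phi> b)"
    "\<forall>v\<in>V. (\<forall>b\<in>D. \<phi> b v = 0) \<longrightarrow> v \<in> V'"
proof -
  obtain B' where B': "B' \<subseteq> V'" "independent B'" "V' \<subseteq> span B'" "card B' = dim V'"
    by (rule basis_exists)
  obtain B where B: "B' \<subseteq> B" "B \<subseteq> V" "independent B" "V \<subseteq> span B"
    using maximal_independent_subset_extend[OF subset_trans[OF B'(1) V'(2)] B'(2)] by auto
  have fin: "finite B" using independent_span_bound[OF V(2) B(3)] B(2) V(3) by auto
  have cB: "card B = dim V" using basis_card_eq_dim B by blast
  let ?E = "extend_basis B"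
  have E: "independent ?E" "span ?E = UNIV" "B \<subseteq> ?E"
    using B(3) by (auto simp: independent_extend_basis extend_basis_superset)
  define \<phi> where "\<phi> b v = representation ?E v b" for b v
  show thesis
  proof
    show "B - B' \<subseteq> V" "finite (B - B')" using B fin by auto
    show "card (B - B') + dim V' = dim V"
      using B(1) B'(4) cB fin by (metis card_Diff_subset card_mono finite_subset le_add_diff_inverse2)
    have "B \<subseteq> V' \<union> (B - B')" using B'(1) by auto
    then show "V \<subseteq> span (V' \<union> (B - B'))" using B(4) span_mono by blast
    show "\<forall>b. Vector_Spaces.linear scale (*) (\<phi> b)"
      unfolding \<phi>_def using linear_representation E by blast
    show "\<forall>v\<in>V. (\<forall>b\<in>B - B'. \<phi> b v = 0) \<longrightarrow> v \<in> V'"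
    proof (intro ballI impI)
      fix v assume v: "v \<in> V" and z: "\<forall>b\<in>B - B'. \<phi> b v = 0"
      have rep: "representation ?E v = representation B v"
        using representation_extend[OF E(1) _ E(3)] v B(4) by auto
      have "(\<Sum>b | representation B v b \<noteq> 0. scale (representation B v b) b) \<in> V'"
      proof (rule subspace_sum[OF V'(1)])
        fix b assume "b \<in> {b. representation B v b \<noteq> 0}"
        then have "b \<in> B" "\<phi> b v \<noteq> 0"
          using representation_ne_zero by (auto simp: \<phi>_def rep)
        then have "b \<in> V'" using z B'(1) by auto
        then show "scale (representation B v b) b \<in> V'" using V'(1) subspace_scale by blast
      qed
      then show "v \<in> V'"
        using sum_nonzero_representation_eq[OF B(3)] v B(4) by auto
    qed
  qed
qed

lemma dim_mono_fin_dim: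
  assumes "V' \<subseteq> V" "V \<subseteq> span S" "finite S"
  shows "dim V' \<le> dim V"
proof -
  obtain B where B: "B \<subseteq> V" "independent B" "V \<subseteq> span B" "card B = dim V"
    by (rule basis_exists)
  then have "finite B" using independent_span_bound[OF assms(3) B(2)] assms(2) by auto
  then show ?thesis using dim_le_card[of V' B] B assms(1) by auto
qed

end

section \<open>Modules over a filtered algebra\<close>

locale filtered_algebra_module = filtered_algebra scale F + module_action act
  for scale :: "'k::field \<Rightarrow> 'a::ring_1 \<Rightarrow> 'a"
    and F :: "nat \<Rightarrow> 'a set"
    and act :: "'a \<Rightarrow> 'm::ab_group_add \<Rightarrow> 'm" +
  assumes left_or_right: "left_module act \<or> right_module act"
begin

abbreviation mscale :: "'k \<Rightarrow> 'm \<Rightarrow> 'm" where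
  "mscale \<equiv> module_scale scale act"

lemma act_mult_either:
  "(\<forall>a b m. act (a * b) m = act a (act b m)) \<or> (\<forall>a b m. act (a * b) m = act b (act a m))"
  using left_or_right left_module.act_mult right_module.act_mult by blast

lemma scalar_central: "scale c 1 * a = a * scale c 1"
  by (simp add: scale_mult_left scale_mult_right)

lemma act_scale_left: "act (scale c a) m = mscale c (act a m)"
proof -
  have "scale c a = scale c 1 * a" "scale c a = a * scale c 1"
    by (simp_all add: scale_mult_left scale_mult_right)
  then show ?thesis unfolding module_scale_def using act_mult_either by metis
qed

lemma act_mscale_right: "act a (mscale c m) = mscale c (act a m)"
proof -
  have "act a (act (scale c 1) m) = act (scale c 1) (act a m)"
    using act_mult_either scalar_central[of c a] by (elim disjE) metis+
  then show ?thesis unfolding module_scale_def .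
qed

sublocale M: vector_space mscale
proof
  fix c d :: 'k and x y :: 'm
  show "mscale c (x + y) = mscale c x + mscale c y"
    by (simp add: module_scale_def act_add_right)
  show "mscale (c + d) x = mscale c x + mscale d x"
    by (simp add: module_scale_def scale_left_distrib act_add_left)
  show "mscale c (mscale d x) = mscale (c * d) x"
    using act_scale_left[of c "scale d 1" x] by (simp add: module_scale_def)
  show "mscale 1 x = x"
    by (simp add: module_scale_def act_one)
qed

lemma act_linear_right: "Vector_Spaces.linear mscale mscale (act a)"
  by unfold_locales (simp_all add: act_add_right act_mscale_right)

lemma act_linear_left: "Vector_Spaces.linear scale mscale (\<lambda>a. act a m)"
  by unfold_locales (simp_all add: act_add_left act_scale_left)

lemma submodule_subspace: "submodule act N \<Longrightarrow> M.subspace N"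
  unfolding submodule_def by (intro M.subspaceI) (auto simp: module_scale_def)

text \<open>
  The factor that acts first is \<open>b\<close> on a left module and \<open>a\<close> on a right module; assuming the
  same of both makes the lemma fit either side.
\<close>

lemma act_sandwich_mem:
  assumes N: "submodule act N"
    and ab: "act \<delta> (act a m) \<in> N" "act \<delta> (act b m) \<in> N"
  shows "act (a * \<delta> * b) m \<in> N"
proof -
  have "act c x \<in> N" if "x \<in> N" for c x using N that unfolding submodule_def by blast
  then have "act a (act \<delta> (act b m)) \<in> N" "act b (act \<delta> (act a m)) \<in> N" using ab by blast+
  then show ?thesis using act_mult_either by (elim disjE) simp_all
qed

text \<open>
  If \<open>\<delta>\<close> sent the whole induced step into \<open>N'\<close>, then every product \<open>a * \<delta> * b\<close> with
  \<open>a, b \<in> F (C * i)\<close> would send \<open>m\<close> into \<open>N'\<close>, and hence so would \<open>1\<close>, which lies in their span.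
\<close>

lemma nonzero_acts_nontrivially:
  assumes ls: "linearly_simple scale F C" and G: "compatible_filtration scale F act G"
    and N: "submodule act N" and N': "submodule act N'"
    and m: "m \<in> G i" "m \<in> N" "m \<notin> N'" and \<delta>: "\<delta> \<in> F i" "\<delta> \<noteq> 0"
  shows "\<exists>x \<in> G ((C + 1) * i) \<inter> N. act \<delta> x \<notin> N'"
proof (rule ccontr)
  assume "\<not> ?thesis"
  then have contr: "act \<delta> x \<in> N'" if "x \<in> G ((C + 1) * i)" "x \<in> N" for x
    using that by auto
  have "act \<delta> (act a m) \<in> N'" if "a \<in> F (C * i)" for a
  proof (rule contr)
    have "act a m \<in> G (C * i + i)" using G that m(1) unfolding compatible_filtration_def by blast
    then show "act a m \<in> G ((C + 1) * i)" by (simp add: algebra_simps)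
    show "act a m \<in> N" using N m(2) unfolding submodule_def by blast
  qed
  then have sub: "{a * \<delta> * b | a b. a \<in> F (C * i) \<and> b \<in> F (C * i)} \<subseteq> {x. act x m \<in> N'}"
    using act_sandwich_mem[OF N'] by auto
  interpret am: Vector_Spaces.linear scale mscale "\<lambda>a. act a m" by (rule act_linear_left)
  have "subspace {x. act x m \<in> N'}"
    using submodule_subspace[OF N'] by (rule am.subspace_vimage[unfolded vimage_def])
  then have "span {a * \<delta> * b | a b. a \<in> F (C * i) \<and> b \<in> F (C * i)} \<subseteq> {x. act x m \<in> N'}"
    using span_minimal[OF sub] by simp
  moreover have "1 \<in> span {a * \<delta> * b | a b. a \<in> F (C * i) \<and> b \<in> F (C * i)}"
    using ls \<delta> unfolding linearly_simple_def by blast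
  ultimately show False using m(3) act_one by auto
qed

lemma subspace_filtration_inter:
  assumes "compatible_filtration scale F act G" "submodule act N"
  shows "M.subspace (G i \<inter> N)" "\<exists>S. finite S \<and> G i \<inter> N \<subseteq> M.span S"
proof -
  have "fin_dim_subspace mscale (G i)"
    using assms(1) unfolding compatible_filtration_def exhaustive_fin_dim_seq_def by blast
  then have "M.subspace (G i)" "\<exists>S. finite S \<and> G i \<subseteq> M.span S"
    unfolding fin_dim_subspace_def by blast+
  then show "M.subspace (G i \<inter> N)" "\<exists>S. finite S \<and> G i \<inter> N \<subseteq> M.span S"
    using submodule_subspace[OF assms(2)] M.subspace_inter by blast+
qed

text \<open>
  An element of \<open>F i\<close> acts as a linear map from the step \<open>(C + 1) * i\<close> of the filtration on
  \<open>N/N'\<close> to the step \<open>(C + 2) * i\<close>. The entries of its matrix are linear in the element and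
  vanish together only at \<open>0\<close>, so there are at least \<open>dim (F i)\<close> of them. The number \<open>q k\<close>
  is the dimension of the step \<open>k\<close>.
\<close>

lemma bernstein_subquotient:
  assumes ls: "linearly_simple scale F C" and G: "compatible_filtration scale F act G"
    and N: "submodule act N" and N': "submodule act N'" "N' \<subseteq> N"
    and m: "m \<in> G i" "m \<in> N" "m \<notin> N'"
  defines "q \<equiv> \<lambda>k. M.dim (G k \<inter> N) - M.dim (G k \<inter> N')"
  shows "dim (F i) \<le> q ((C + 1) * i) * q ((C + 2) * i)"
proof -
  let ?U = "G ((C + 1) * i) \<inter> N" and ?U' = "G ((C + 1) * i) \<inter> N'"
  let ?V = "G ((C + 2) * i) \<inter> N" and ?V' = "G ((C + 2) * i) \<inter> N'"
  note sN = subspace_filtration_inter[OF G N] and sN' = subspace_filtration_inter[OF G N'(1)]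
  have sub: "?U' \<subseteq> ?U" "?V' \<subseteq> ?V" using N'(2) by auto
  obtain S where S: "finite S" "?U \<subseteq> M.span S" using sN(2) by blast
  obtain D \<psi> where D: "D \<subseteq> ?U" "finite D" "card D + M.dim ?U' = M.dim ?U"
    "?U \<subseteq> M.span (?U' \<union> D)"
    and "\<forall>b. Vector_Spaces.linear mscale (*) (\<psi> b)"
      "\<forall>u\<in>?U. (\<forall>b\<in>D. \<psi> b u = 0) \<longrightarrow> u \<in> ?U'"
    by (rule M.relative_basis[OF sN(1) S sN'(1) sub(1)])
  obtain T where T: "finite T" "?V \<subseteq> M.span T" using sN(2) by blast
  obtain E \<phi> where "E \<subseteq> ?V" and E: "finite E" "card E + M.dim ?V' = M.dim ?V"
    and "?V \<subseteq> M.span (?V' \<union> E)"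
    and \<phi>: "\<forall>b. Vector_Spaces.linear mscale (*) (\<phi> b)"
      "\<forall>v\<in>?V. (\<forall>b\<in>E. \<phi> b v = 0) \<longrightarrow> v \<in> ?V'"
    by (rule M.relative_basis[OF sN(1) T sN'(1) sub(2)])
  have "dim (F i) \<le> card (D \<times> E)"
  proof (rule dim_le_card_if_joint_kernel_trivial)
    show "finite (D \<times> E)" using D E by simp
    show "subspace (F i)"
      using seq unfolding exhaustive_fin_dim_seq_def fin_dim_subspace_def by blast
    define f where "f = (\<lambda>(u, b). \<lambda>\<delta>. \<phi> b (act \<delta> u))"
    show "Vector_Spaces.linear scale (*) (f p)" for p
      using Vector_Spaces.linear_compose[OF act_linear_left \<phi>(1)[rule_format]]
      by (cases p) (simp add: f_def comp_def)
    fix \<delta> assume \<delta>: "\<delta> \<in> F i" and "\<forall>p\<in>D \<times> E. f p \<delta> = 0"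
    then have zero: "\<phi> b (act \<delta> u) = 0" if "u \<in> D" "b \<in> E" for u b
      using that by (auto simp: f_def)
    have "act \<delta> u \<in> N'" if u: "u \<in> D" for u
    proof -
      have "u \<in> G ((C + 1) * i)" "u \<in> N" using u D(1) by auto
      then have "act \<delta> u \<in> G (i + (C + 1) * i)" "act \<delta> u \<in> N"
        using G N \<delta> unfolding compatible_filtration_def submodule_def by blast+
      then have "act \<delta> u \<in> ?V" by (simp add: algebra_simps)
      then show ?thesis using \<phi>(2) zero u by blast
    qed
    moreover have "act \<delta> u \<in> N'" if "u \<in> ?U'" for u
      using that N'(1) unfolding submodule_def by blast
    ultimately have sub: "?U' \<union> D \<subseteq> {x. act \<delta> x \<in> N'}" by auto
    interpret ad: Vector_Spaces.linear mscale mscale "act \<delta>" by (rule act_linear_right)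
    have "M.subspace {x. act \<delta> x \<in> N'}"
      using submodule_subspace[OF N'(1)] by (rule ad.subspace_vimage[unfolded vimage_def])
    then have "?U \<subseteq> {x. act \<delta> x \<in> N'}"
      using M.span_minimal[OF sub] D(4) by blast
    then show "\<delta> = 0"
      using nonzero_acts_nontrivially[OF ls G N N'(1) m \<delta>] by blast
  qed
  also have "\<dots> = q ((C + 1) * i) * q ((C + 2) * i)"
    unfolding q_def card_cartesian_product D(3)[symmetric] E(2)[symmetric] by simp
  finally show ?thesis .
qed

text \<open>
  The threshold for \<open>i\<close> comes from the factors: each needs a nonzero class represented in \<open>G i\<close>.
  The bound uses \<open>\<Sum>\<^sub>j x\<^sub>j y\<^sub>j \<le> (\<Sum>\<^sub>j x\<^sub>j) (\<Sum>\<^sub>j y\<^sub>j)\<close>, after which both sums telescope.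
\<close>

lemma chain_dim_bound:
  assumes ls: "linearly_simple scale F C" and G: "compatible_filtration scale F act G"
    and sm: "\<forall>j\<le>n. submodule act (N j)"
    and strict: "\<forall>j<n. N j \<subset> N (Suc j)"
  shows "\<forall>\<^sub>F i in sequentially.
    n * dim (F i) \<le> M.dim (G ((C + 1) * i)) * M.dim (G ((C + 2) * i))"
proof -
  define q where "q j k = M.dim (G k \<inter> N (Suc j)) - M.dim (G k \<inter> N j)" for j k
  have mono: "M.dim (G k \<inter> N j) \<le> M.dim (G k \<inter> N (Suc j))" if "j < n" for j k
  proof -
    have N: "submodule act (N (Suc j))" "N j \<subseteq> N (Suc j)"
      using sm strict that by (simp_all add: less_imp_le)
    obtain S where S: "finite S" "G k \<inter> N (Suc j) \<subseteq> M.span S"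
      using subspace_filtration_inter(2)[OF G N(1)] by blast
    have "G k \<inter> N j \<subseteq> G k \<inter> N (Suc j)" using N(2) by (rule Int_mono[OF order_refl])
    then show ?thesis by (rule M.dim_mono_fin_dim[OF _ S(2,1)])
  qed
  have telescope: "(\<Sum>j<r. q j k) + M.dim (G k \<inter> N 0) = M.dim (G k \<inter> N r)" if "r \<le> n" for r k
    using that
  proof (induction r)
    case (Suc r)
    then show ?case using mono[of r k] by (simp add: q_def)
  qed simp
  have total: "(\<Sum>j<n. q j k) \<le> M.dim (G k)" for k
  proof -
    have "fin_dim_subspace mscale (G k)"
      using G unfolding compatible_filtration_def exhaustive_fin_dim_seq_def by blast
    then obtain S where S: "finite S" "G k \<subseteq> M.span S" unfolding fin_dim_subspace_def by blast
    have "M.dim (G k \<inter> N n) \<le> M.dim (G k)" by (rule M.dim_mono_fin_dim[OF Int_lower1 S(2,1)])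
    then show ?thesis using telescope[of n k] by simp
  qed
  have "\<forall>\<^sub>F i in sequentially. dim (F i) \<le> q j ((C + 1) * i) * q j ((C + 2) * i)"
    if j: "j < n" for j
  proof -
    have Nj: "submodule act (N (Suc j))" "submodule act (N j)" "N j \<subseteq> N (Suc j)"
      using sm strict j by (simp_all add: less_imp_le)
    obtain m where m: "m \<in> N (Suc j)" "m \<notin> N j" using strict j by blast
    have Gm: "mono G" "(\<Union>i. G i) = UNIV"
      using G unfolding compatible_filtration_def exhaustive_fin_dim_seq_def by auto
    then obtain s where s: "m \<in> G s" by blast
    show ?thesis
      using eventually_ge_at_top[of s]
    proof eventually_elim
      case (elim i)
      then have "m \<in> G i" using s Gm(1) monoD by blast
      then show ?case
        unfolding q_def by (rule bernstein_subquotient[OF ls G Nj _ m])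
    qed
  qed
  then have "\<forall>j\<in>{..<n}. \<forall>\<^sub>F i in sequentially. dim (F i) \<le> q j ((C + 1) * i) * q j ((C + 2) * i)"
    by blast
  then have "\<forall>\<^sub>F i in sequentially. \<forall>j\<in>{..<n}. dim (F i) \<le> q j ((C + 1) * i) * q j ((C + 2) * i)"
    by (rule eventually_ball_finite[OF finite_lessThan])
  then show ?thesis
  proof eventually_elim
    case (elim i)
    have "n * dim (F i) = (\<Sum>j<n. dim (F i))" by simp
    also have "\<dots> \<le> (\<Sum>j<n. q j ((C + 1) * i) * q j ((C + 2) * i))"
      using elim by (intro sum_mono) auto
    also have "\<dots> \<le> (\<Sum>j<n. q j ((C + 1) * i) * (\<Sum>l<n. q l ((C + 2) * i)))"
      by (rule sum_mono, rule mult_left_mono, rule member_le_sum) simp_all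
    also have "\<dots> = (\<Sum>j<n. q j ((C + 1) * i)) * (\<Sum>j<n. q j ((C + 2) * i))"
      by (simp add: sum_distrib_right)
    also have "\<dots> \<le> M.dim (G ((C + 1) * i)) * M.dim (G ((C + 2) * i))"
      by (rule mult_mono[OF total total]) simp_all
    finally show ?case .
  qed
qed

end

section \<open>Dimension and multiplicity\<close>

lemma filt_dim_nonneg: "0 \<le> filt_dim scale G"
  unfolding filt_dim_def by (auto intro!: Inf_greatest)

lemma filt_mult_nonneg: "0 \<le> filt_mult scale G"
  unfolding filt_mult_def by (auto intro!: le_Limsup always_eventually)

text \<open>
  Any \<open>E' > E\<close> eventually bounds \<open>g j / j powr \<theta>\<close>, in particular along the multiples of
  \<open>a\<close> and \<open>b\<close>; the bound for \<open>E\<close> itself follows by letting \<open>E'\<close> decrease to \<open>E\<close>.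
\<close>

lemma limsup_product_bound:
  fixes f g :: "nat \<Rightarrow> real" and n a b :: nat
  assumes pos: "n > 0" "a > 0" "b > 0" and g0: "\<And>i. 0 \<le> g i"
    and fg: "\<forall>\<^sub>F i in sequentially. real n * f i \<le> g (a * i) * g (b * i)"
    and E: "limsup (\<lambda>i. ereal (g i / real i powr \<theta>)) = ereal E"
  shows "limsup (\<lambda>i. ereal (f i / real i powr (2 * \<theta>)))
           \<le> ereal (E\<^sup>2 * (real a powr \<theta> * real b powr \<theta>) / n)" (is "?L \<le> _")
proof -
  let ?K = "real a powr \<theta> * real b powr \<theta>"
  have bound: "?L \<le> ereal (E'\<^sup>2 * ?K / n)" if "E < E'" for E'
  proof (rule Limsup_bounded)
    have "\<forall>\<^sub>F i in sequentially. ereal (g i / real i powr \<theta>) < ereal E'"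
      using that E by (intro Limsup_lessD) simp
    then have ev: "\<forall>\<^sub>F i in sequentially. g i \<le> E' * real i powr \<theta>"
      using eventually_gt_at_top[of 0] by eventually_elim (simp add: field_simps)
    have scaled: "\<forall>\<^sub>F i in sequentially. g (c * i) \<le> E' * real (c * i) powr \<theta>" if "c > 0" for c :: nat
    proof -
      have "filterlim (\<lambda>i. c * i) sequentially sequentially"
        using that by (intro filterlim_subseq strict_monoI) simp
      from eventually_compose_filterlim[OF ev this] show ?thesis .
    qed
    show "\<forall>\<^sub>F i in sequentially. ereal (f i / real i powr (2 * \<theta>)) \<le> ereal (E'\<^sup>2 * ?K / n)"
      using fg scaled[OF pos(2)] scaled[OF pos(3)] eventually_gt_at_top[of 0]
    proof eventually_elim
      case (elim i)
      have "real n * f i \<le> (E' * real (a * i) powr \<theta>) * (E' * real (b * i) powr \<theta>)"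
        using elim g0 by (meson mult_mono order_trans)
      also have "\<dots> = E'\<^sup>2 * ?K * real i powr (2 * \<theta>)"
        by (simp only: of_nat_mult powr_mult power2_eq_square mult_2 powr_add) (simp only: ac_simps)
      finally have "real n * f i \<le> E'\<^sup>2 * ?K * real i powr (2 * \<theta>)" .
      moreover have "real i powr (2 * \<theta>) > 0" using elim(4) by simp
      moreover have "f / p \<le> c / real n" if "real n * f \<le> c * p" "p > 0" for f p c :: real
        using that pos(1) by (simp add: field_simps)
      ultimately have "f i / real i powr (2 * \<theta>) \<le> E'\<^sup>2 * ?K / n" by presburger
      then show ?case by simp
    qed
  qed
  have "((\<lambda>E'. ereal (E'\<^sup>2 * ?K / n)) \<longlongrightarrow> ereal (E\<^sup>2 * ?K / n)) (at_right E)"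
    by (intro tendsto_intros) (use pos in auto)
  moreover have "\<forall>\<^sub>F E' in at_right E. ?L \<le> ereal (E'\<^sup>2 * ?K / n)"
    using bound by (intro eventually_at_right_less[THEN eventually_mono]) auto
  ultimately show ?thesis by (rule tendsto_lowerbound) simp
qed

context filtered_algebra_module
begin

lemma chain_length_bound:
  assumes ls: "linearly_simple scale F C" and G: "compatible_filtration scale F act G"
    and dF: "filt_dim scale F = ereal (2 * \<theta>)" and eF: "filt_mult scale F = ereal e" "e > 0"
    and dG: "filt_dim mscale G = ereal \<theta>" and eG: "filt_mult mscale G = ereal E"
    and sm: "\<forall>j\<le>n. submodule act (N j)"
    and strict: "\<forall>j<n. N j \<subset> N (Suc j)"
  shows "real n \<le> E\<^sup>2 * ((real C + 1) powr \<theta> * (real C + 2) powr \<theta>) / e"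
proof (cases "n = 0")
  case True
  then show ?thesis using eF(2) by simp
next
  case False
  have "\<forall>\<^sub>F i in sequentially. real n * real (dim (F i))
      \<le> real (M.dim (G ((C + 1) * i))) * real (M.dim (G ((C + 2) * i)))"
    using chain_dim_bound[OF ls G sm strict]
    by (rule eventually_mono) (use of_nat_mono in fastforce)
  moreover have "limsup (\<lambda>i. ereal (real (M.dim (G i)) / real i powr \<theta>)) = ereal E"
    using dG eG by (simp add: filt_mult_def)
  ultimately have "limsup (\<lambda>i. ereal (real (dim (F i)) / real i powr (2 * \<theta>)))
      \<le> ereal (E\<^sup>2 * (real (C + 1) powr \<theta> * real (C + 2) powr \<theta>) / n)"
    using False by (intro limsup_product_bound) auto
  then have "e \<le> E\<^sup>2 * ((real C + 1) powr \<theta> * (real C + 2) powr \<theta>) / n"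
    using dF eF by (simp add: filt_mult_def algebra_simps)
  then show ?thesis using False eF(2) by (simp add: field_simps)
qed

end

lemma module_length_le:
  assumes "\<And>n N. N 0 = {0} \<Longrightarrow> N n = UNIV \<Longrightarrow> \<forall>j\<le>n. submodule act (N j) \<Longrightarrow>
    \<forall>j<n. N j \<subset> N (Suc j) \<Longrightarrow> real n \<le> B"
  shows "module_length act < \<infinity>" "0 \<le> B \<Longrightarrow> ereal_of_enat (module_length act) \<le> ereal B"
proof -
  have le: "module_length act \<le> enat (nat \<lfloor>B\<rfloor>)"
    unfolding module_length_def
  proof (rule Sup_least, clarify)
    fix n N
    assume "N 0 = {0}" "N n = UNIV" "\<forall>i\<le>n. submodule act (N i)" "\<forall>i<n. N i \<subset> N (Suc i)"
    then have "real n \<le> B" by (rule assms[of N n])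
    then show "enat n \<le> enat (nat \<lfloor>B\<rfloor>)" by (simp add: le_nat_floor)
  qed
  then show "module_length act < \<infinity>" using enat_ord_simps(4) le_less_trans by blast
  assume "0 \<le> B"
  then have "real (nat \<lfloor>B\<rfloor>) \<le> B" by simp
  moreover have "ereal_of_enat (module_length act) \<le> ereal_of_enat (enat (nat \<lfloor>B\<rfloor>))"
    using le by (simp only: ereal_of_enat_le_iff)
  ultimately show "ereal_of_enat (module_length act) \<le> ereal B"
    by (metis ereal_less_eq(3) ereal_of_enat_simps(1) order_trans)
qed

lemma zero_module_length:
  fixes act :: "'a::ring_1 \<Rightarrow> 'm::ab_group_add \<Rightarrow> 'm"
  assumes "(UNIV :: 'm set) = {0}"
  shows "module_length act < \<infinity>"
proof (rule module_length_le(1)[where B = 0])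
  fix n and N :: "nat \<Rightarrow> 'm set"
  assume "N 0 = {0}" "\<forall>j<n. N j \<subset> N (Suc j)"
  then have "\<not> 0 < n" using assms by fast
  then show "real n \<le> 0" by simp
qed

theorem theorem3p8:
  fixes scale :: "'k::field \<Rightarrow> 'a::ring_1 \<Rightarrow> 'a"
    and F :: "nat \<Rightarrow> 'a set"
    and C :: nat
    and act :: "'a \<Rightarrow> 'm::ab_group_add \<Rightarrow> 'm"
    and \<theta> :: real
  assumes "filtered_algebra scale F"
    and "C > 0"
    and "linearly_simple scale F C"
    and "filt_dim scale F < \<infinity>"
    and "0 < filt_mult scale F" and "filt_mult scale F < \<infinity>"
    and "left_module act \<or> right_module act"
    and "holonomic scale F act"
    and "\<theta> = real_of_ereal (filt_dim scale F) / 2"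
  shows "module_length act < \<infinity> \<and>
    (\<forall>G. compatible_filtration scale F act G \<longrightarrow>
         filt_dim (module_scale scale act) G = ereal \<theta> \<longrightarrow>
         filt_mult (module_scale scale act) G < \<infinity> \<longrightarrow>
         ereal_of_enat (module_length act)
           \<le> (filt_mult (module_scale scale act) G)\<^sup>2 *
              ereal ((real C + 1) powr \<theta> * (real C + 2) powr \<theta>) / filt_mult scale F)"
proof -
  interpret filtered_algebra_module scale F act
  proof (intro filtered_algebra_module.intro filtered_algebra_module_axioms.intro)
    show "module_action act"
      using assms(7) left_module.axioms(1) right_module.axioms(1) by blast
  qed (fact assms(1), fact assms(7))
  have dF: "filt_dim scale F = ereal (2 * \<theta>)"
    using assms(4,9) filt_dim_nonneg[of scale F] by (cases "filt_dim scale F") auto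
  obtain e where e: "filt_mult scale F = ereal e" "e > 0"
    using assms(5,6) by (cases "filt_mult scale F") auto
  have bounds: "module_length act < \<infinity> \<and> ereal_of_enat (module_length act)
      \<le> (filt_mult mscale G)\<^sup>2 *
         ereal ((real C + 1) powr \<theta> * (real C + 2) powr \<theta>) / filt_mult scale F"
    if G: "compatible_filtration scale F act G" "filt_dim mscale G = ereal \<theta>"
      "filt_mult mscale G < \<infinity>" for G
  proof -
    obtain E where E: "filt_mult mscale G = ereal E"
      using G(3) filt_mult_nonneg[of mscale G] by (cases "filt_mult mscale G") auto
    let ?B = "E\<^sup>2 * ((real C + 1) powr \<theta> * (real C + 2) powr \<theta>) / e"
    have chain: "real n \<le> ?B"
      if "\<forall>j\<le>n. submodule act (N j)" "\<forall>j<n. N j \<subset> N (Suc j)" for n N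
      by (rule chain_length_bound[OF assms(3) G(1) dF e G(2) E that])
    have "module_length act < \<infinity>"
      by (rule module_length_le(1)[where B = ?B]) (rule chain)
    moreover have "0 \<le> ?B \<Longrightarrow> ereal_of_enat (module_length act) \<le> ereal ?B"
      by (rule module_length_le(2)) (rule chain)
    moreover have "0 \<le> ?B" using e(2) by simp
    moreover have "(filt_mult mscale G)\<^sup>2 *
        ereal ((real C + 1) powr \<theta> * (real C + 2) powr \<theta>) / filt_mult scale F = ereal ?B"
      using e by (simp add: E)
    ultimately show ?thesis by simp
  qed
  have "module_length act < \<infinity>"
  proof (cases "(UNIV :: 'm set) = {0}")
    case True
    then show ?thesis by (rule zero_module_length)
  next
    case False
    then obtain G where G: "compatible_filtration scale F act G"
      "filt_dim mscale G = filt_dim scale F / 2" "filt_mult mscale G < \<infinity>"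
      using assms(8) unfolding holonomic_def by blast
    have "filt_dim mscale G = ereal \<theta>" using G(2) dF by simp
    then show ?thesis using bounds[OF G(1) _ G(3)] by blast
  qed
  then show ?thesis using bounds by blast
qed

end
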